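(* There exist a non-empty complete metric space $(X,\rho)$ and two continuous maps $S,T:X\to X$ such that: (i) for all $x,y\in X$, $\min\{\rho(S(x),S(y)),\rho(T(x),T(y))\}\le \frac34\,\rho(x,y)$; and (ii) no member of the semigroup generated by $\{S,T\}$ under composition (that is, no composition $R_k\circ R_{k-1}\circ\cdots\circ R_1$ with $k\ge 1$ and each $R_i\in\{S,T\}$) has a fixed point in $X$. *)

theory Defs
  imports "HOL-Analysis.Abstract_Metric_Spaces"
begin

inductive_set generated_semigroup :: "('a \<Rightarrow> 'a) set \<Rightarrow> ('a \<Rightarrow> 'a) set"
  for F :: "('a \<Rightarrow> 'a) set"
where
  generator: "R \<in> F \<Longrightarrow> R \<in> generated_semigroup F"
| comp: "f \<in> generated_semigroup F \<Longrightarrow> g \<in> generated_semigroup F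
    \<Longrightarrow> f \<circ> g \<in> generated_semigroup F"

lemma generated_semigroup_iff_words:
  "f \<in> generated_semigroup F \<longleftrightarrow>
     (\<exists>Rs. Rs \<noteq> [] \<and> set Rs \<subseteq> F \<and> f = foldr (\<circ>) Rs id)"
proof
  assume "f \<in> generated_semigroup F"
  then show "\<exists>Rs. Rs \<noteq> [] \<and> set Rs \<subseteq> F \<and> f = foldr (\<circ>) Rs id"
  proof induction
    case (generator R)
    then show ?case by (intro exI[of _ "[R]"]) simp
  next
    case (comp f g)
    then obtain Rs Qs where
      Rs: "Rs \<noteq> []" "set Rs \<subseteq> F" "f = foldr (\<circ>) Rs id" and
      Qs: "set Qs \<subseteq> F" "g = foldr (\<circ>) Qs id" by blast
    have "foldr (\<circ>) Rs h = foldr (\<circ>) Rs id \<circ> h" for h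
      by (induction Rs) (simp_all add: comp_assoc)
    from this[of g] have "f \<circ> g = foldr (\<circ>) (Rs @ Qs) id"
      using Rs(3) Qs(2) by simp
    moreover have "Rs @ Qs \<noteq> []" "set (Rs @ Qs) \<subseteq> F"
      using Rs(1,2) Qs(1) by simp_all
    ultimately show ?case by blast
  qed
next
  have words: "Rs \<noteq> [] \<Longrightarrow> set Rs \<subseteq> F \<Longrightarrow> foldr (\<circ>) Rs id \<in> generated_semigroup F" for Rs
    by (induction Rs rule: list_nonempty_induct)
      (auto intro: generated_semigroup.intros)
  assume "\<exists>Rs. Rs \<noteq> [] \<and> set Rs \<subseteq> F \<and> f = foldr (\<circ>) Rs id"
  then show "f \<in> generated_semigroup F"
    using words by blast
qed

text \<open>
  HOL cannot quantify existentially over types, so the metric space of the theorem is given by a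
  carrier \<open>X :: real set\<close> with an arbitrary metric \<open>\<rho>\<close> on it, unrelated to the usual
  distance of the reals. Nothing is lost: in any complete metric space with two continuous
  self-maps, the closure of the orbit of a point under the generated semigroup is a separable
  complete invariant subspace, hence has at most continuum cardinality and can be relabelled by reals.
\<close>

end

theory Submission
  imports Defs
begin

text \<open>
  Give a nonempty finite binary word \<open>u\<close> the weight \<open>a(u) = 2\<^sup>-\<^sup>\<pi>\<close>, where \<open>\<pi>\<close> is the least
  period of \<open>u\<close>. A periodic infinite word has prefixes whose weights sum to infinity, so it does not
  belong to the space \<open>X\<close> of infinite words for which this sum is finite. On \<open>X\<close> use the path
  metric of the weighted prefix tree: the distance of \<open>x\<close> and \<open>y\<close> is the total weight of the
  prefixes of \<open>x\<close> and \<open>y\<close> that they do not share. Weights of prefixes of a fixed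
  length are bounded below, so Cauchy sequences converge letterwise, and partial sums of the metric
  pass to the limit: the metric is complete.

  The two maps prepend a letter, so a fixed point of a composition would be periodic. Prepending a letter
  to \<open>u\<close> never decreases the least period, and at most one of the two letters preserves it; hence
  \<open>a(0u) + a(1u) \<le> 2\<^sup>-\<^sup>\<pi> + 2\<^sup>-\<^sup>\<pi>\<^sup>-\<^sup>1 = 3/2 a(u)\<close>. Summing over the unshared prefixes, the two image
  distances add up to at most \<open>3/2\<close> of the original one, so the smaller is at most \<open>3/4\<close> of it.
\<close>

section \<open>Least periods and weights of prefixes\<close>

definition has_period :: "nat \<Rightarrow> nat \<Rightarrow> (nat \<Rightarrow> bool) \<Rightarrow> bool" where
  "has_period p k x \<longleftrightarrow> p > 0 \<and> (\<forall>i. i + p < k \<longrightarrow> x (i + p) = x i)"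

text \<open>Finite words are encoded as prefixes of length \<open>k\<close>. Every positive
  \<open>p \<ge> k\<close> is vacuously a period, so the least one exists; it is 1 for the empty
  prefix.\<close>

definition minper :: "nat \<Rightarrow> (nat \<Rightarrow> bool) \<Rightarrow> nat" where
  "minper k x = (LEAST p. has_period p k x)"

definition weight :: "(nat \<Rightarrow> bool) \<Rightarrow> nat \<Rightarrow> real" where
  "weight x k = (1/2) ^ minper k x"

definition agree :: "nat \<Rightarrow> (nat \<Rightarrow> bool) \<Rightarrow> (nat \<Rightarrow> bool) \<Rightarrow> bool" where
  "agree k x y \<longleftrightarrow> (\<forall>i<k. x i = y i)"

definition gap :: "(nat \<Rightarrow> bool) \<Rightarrow> (nat \<Rightarrow> bool) \<Rightarrow> nat \<Rightarrow> real" where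
  "gap x y k = (if agree k x y then 0 else weight x k + weight y k)"

definition finite_ends :: "(nat \<Rightarrow> bool) set" where
  "finite_ends = {x. summable (weight x)}"

text \<open>The value 0 outside the space only serves the axiom \<open>0 \<le> d x y\<close> of \<open>Metric_space\<close>,
  which is not relativised to the carrier.\<close>

definition tdist :: "(nat \<Rightarrow> bool) \<Rightarrow> (nat \<Rightarrow> bool) \<Rightarrow> real" where
  "tdist x y = (if x \<in> finite_ends \<and> y \<in> finite_ends then \<Sum>k. gap x y k else 0)"

definition push :: "bool \<Rightarrow> (nat \<Rightarrow> bool) \<Rightarrow> nat \<Rightarrow> bool" where
  "push b x = case_nat b x"

lemma push_simps [simp]: "push b x 0 = b" "push b x (Suc i) = x i"
  by (simp_all add: push_def)

lemma has_period_minper: "has_period (minper k x) k x"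
  unfolding minper_def by (rule LeastI[of _ "Suc k"]) (simp add: has_period_def)

lemma minper_le: "has_period p k x \<Longrightarrow> minper k x \<le> p"
  unfolding minper_def by (rule Least_le)

lemma minper_le_length: "k > 0 \<Longrightarrow> minper k x \<le> k"
  by (rule minper_le) (simp add: has_period_def)

lemma minper_agree: "agree k x y \<Longrightarrow> minper k x = minper k y"
proof -
  assume "agree k x y"
  then have "has_period p k x = has_period p k y" for p
    unfolding has_period_def agree_def by (metis add_lessD1)
  then show ?thesis by (simp add: minper_def)
qed

lemma has_period_push: "has_period p (Suc k) (push b x) \<Longrightarrow> has_period p k x"
  unfolding has_period_def by (metis Suc_less_eq add_Suc push_simps(2))

lemma minper_push: "minper k x \<le> minper (Suc k) (push b x)"
  by (meson has_period_minper has_period_push minper_le)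

text \<open>A period of \<open>b u\<close> that is at most the length of \<open>u\<close> determines the letter \<open>b\<close>.\<close>

lemma minper_push_unique:
  assumes "k > 0" "minper (Suc k) (push b x) = minper k x"
    "minper (Suc k) (push c x) = minper k x"
  shows "b = c"
proof -
  have *: "d = x (minper k x - 1)" if "minper (Suc k) (push d x) = minper k x" for d
  proof -
    have "has_period (minper k x) (Suc k) (push d x)"
      using has_period_minper that by metis
    moreover have "minper k x \<le> k" by (rule minper_le_length) (rule assms)
    ultimately have "minper k x > 0" "push d x (0 + minper k x) = push d x 0"
      unfolding has_period_def by (simp, metis add_0 le_imp_less_Suc)
    then show ?thesis by (cases "minper k x") auto
  qed
  show ?thesis using *[OF assms(2)] *[OF assms(3)] by simp
qed

lemma weight_pos [simp]: "weight x k > 0"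
  by (simp add: weight_def)

lemma weight_nonneg [simp]: "weight x k \<ge> 0"
  by (simp add: weight_def)

text \<open>Neither weight exceeds \<open>weight x k\<close>, and \<open>minper_push_unique\<close>
  makes one of them at most half of it. At \<open>k = 0\<close> the bound fails: both one-letter
  words keep the least period 1 of the empty prefix.\<close>

lemma weight_push_sum:
  assumes "k > 0"
  shows "weight (push True x) (Suc k) + weight (push False x) (Suc k) \<le> 3/2 * weight x k"
proof -
  have le: "(1/2::real) ^ n \<le> (1/2) ^ m" if "m \<le> n" for m n
    using that by (simp add: power_decreasing)
  let ?m = "minper k x"
  have t: "?m \<le> minper (Suc k) (push True x)" and f: "?m \<le> minper (Suc k) (push False x)"
    by (rule minper_push)+
  moreover have "minper (Suc k) (push True x) \<noteq> ?m \<or> minper (Suc k) (push False x) \<noteq> ?m"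
    using minper_push_unique[OF assms] by blast
  ultimately consider "Suc ?m \<le> minper (Suc k) (push True x)"
    | "Suc ?m \<le> minper (Suc k) (push False x)" by linarith
  then show ?thesis
  proof cases
    case 1
    show ?thesis
      unfolding weight_def using le[OF 1] le[OF f] unfolding power_Suc by linarith
  next
    case 2
    show ?thesis
      unfolding weight_def using le[OF 2] le[OF t] unfolding power_Suc by linarith
  qed
qed

section \<open>Unshared prefixes and the path metric\<close>

lemma agree_push: "agree (Suc k) (push b x) (push b y) \<longleftrightarrow> agree k x y"
  by (auto simp: agree_def less_Suc_eq_0_disj)

lemma agree_0 [simp]: "agree 0 x y"
  by (simp add: agree_def)

lemma agree_mono: "agree k x y \<Longrightarrow> j \<le> k \<Longrightarrow> agree j x y"
  by (simp add: agree_def)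

lemma agree_sym: "agree k x y = agree k y x"
  by (auto simp: agree_def)

lemma gap_nonneg [simp]: "gap x y k \<ge> 0"
  by (simp add: gap_def)

lemma gap_sym: "gap x y = gap y x"
  by (auto simp: gap_def agree_sym fun_eq_iff)

lemma gap_0 [simp]: "gap x y 0 = 0"
  by (simp add: gap_def)

text \<open>If exactly one of the pairs \<open>x\<close>, \<open>y\<close> and \<open>y\<close>,
  \<open>z\<close> agrees, its weights coincide and equality holds; if neither agrees, the right
  side only gains.\<close>

lemma gap_triangle: "gap x z k \<le> gap x y k + gap y z k"
proof -
  have "weight x k = weight y k" if "agree k x y"
    using minper_agree[OF that] by (simp add: weight_def)
  moreover have "weight y k = weight z k" if "agree k y z"
    using minper_agree[OF that] by (simp add: weight_def)
  moreover have "agree k x z" if "agree k x y" "agree k y z"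
    using that by (simp add: agree_def)
  ultimately show ?thesis by (auto simp: gap_def)
qed

lemma gap_push_sum:
  "gap (push True x) (push True y) (Suc k) + gap (push False x) (push False y) (Suc k)
    \<le> 3/2 * gap x y k"
proof (cases "agree k x y")
  case False
  \<comment> \<open>Empty prefixes agree, so disagreement gives the positive length that
    \<open>weight_push_sum\<close> needs.\<close>
  then have "k > 0" by (metis agree_0 gr0I)
  from weight_push_sum[OF this, of x] weight_push_sum[OF this, of y] False
  show ?thesis by (simp add: gap_def agree_push)
qed (simp add: gap_def agree_push)

lemma push_finite_ends:
  assumes "x \<in> finite_ends" shows "push b x \<in> finite_ends"
proof -
  have "summable (\<lambda>k. weight (push b x) (Suc k))"
  proof (rule summable_comparison_test_ev)
    show "summable (weight x)" using assms by (simp add: finite_ends_def)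
    show "\<forall>\<^sub>F k in sequentially. norm (weight (push b x) (Suc k)) \<le> weight x k"
      by (rule always_eventually) (simp add: weight_def minper_push power_decreasing)
  qed
  then show ?thesis by (simp add: finite_ends_def summable_Suc_iff)
qed

lemma summable_gap:
  assumes "x \<in> finite_ends" "y \<in> finite_ends" shows "summable (gap x y)"
proof (rule summable_comparison_test_ev)
  show "summable (\<lambda>k. weight x k + weight y k)"
    using assms by (intro summable_add) (simp_all add: finite_ends_def)
  show "\<forall>\<^sub>F k in sequentially. norm (gap x y k) \<le> weight x k + weight y k"
    by (rule always_eventually) (simp add: gap_def add_nonneg_nonneg)
qed

text \<open>Lets small distances force agreement of prefixes, both for definiteness and for
  completeness.\<close>

lemma gap_le_tdist:
  assumes "x \<in> finite_ends" "y \<in> finite_ends" shows "gap x y k \<le> tdist x y"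
  using sum_le_suminf[OF summable_gap[OF assms], of "{k}"] assms by (simp add: tdist_def)

lemma Metric_space_tdist: "Metric_space finite_ends tdist"
proof
  show "0 \<le> tdist x y" for x y
    by (auto simp: tdist_def intro!: suminf_nonneg summable_gap)
  show "tdist x y = tdist y x" for x y
    by (auto simp: tdist_def gap_sym[of x y])
  show "tdist x y = 0 \<longleftrightarrow> x = y" if "x \<in> finite_ends" "y \<in> finite_ends" for x y
  proof
    assume "tdist x y = 0"
    then have "gap x y k \<le> 0" for k
      using gap_le_tdist[OF that] by metis
    then have "agree k x y" for k
      using add_pos_pos[OF weight_pos weight_pos, of x k y k] by (metis gap_def not_le)
    then show "x = y" by (auto simp: agree_def)
  next
    assume "x = y"
    then have "gap x y = (\<lambda>k. 0)" by (auto simp: gap_def agree_def)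
    then show "tdist x y = 0" by (simp add: tdist_def)
  qed
  show "tdist x z \<le> tdist x y + tdist y z"
    if "x \<in> finite_ends" "y \<in> finite_ends" "z \<in> finite_ends" for x y z
    using that by (auto simp: tdist_def suminf_add summable_gap
        intro!: suminf_le gap_triangle summable_add)
qed

lemma tdist_push_sum:
  assumes "x \<in> finite_ends" "y \<in> finite_ends"
  shows "tdist (push True x) (push True y) + tdist (push False x) (push False y)
    \<le> 3/2 * tdist x y"
proof -
  have sm: "summable (\<lambda>k. gap (push b x) (push b y) (Suc k))" for b
    using summable_gap[OF push_finite_ends[OF assms(1)] push_finite_ends[OF assms(2)]]
    by (simp add: summable_Suc_iff)
  \<comment> \<open>The term at 0 vanishes since empty prefixes agree, so the series may start at
    length 1.\<close>
  have eq: "tdist (push b x) (push b y) = (\<Sum>k. gap (push b x) (push b y) (Suc k))" for b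
    using suminf_split_head[OF summable_gap[OF push_finite_ends[OF assms(1)] push_finite_ends[OF assms(2)]], of b b]
    by (simp add: tdist_def push_finite_ends assms)
  have "(\<Sum>k. gap (push True x) (push True y) (Suc k) + gap (push False x) (push False y) (Suc k))
    \<le> (\<Sum>k. 3/2 * gap x y k)"
    by (intro suminf_le gap_push_sum summable_add sm summable_mult summable_gap assms)
  also have "\<dots> = 3/2 * tdist x y"
    using suminf_mult[OF summable_gap[OF assms], of "3/2"] assms by (simp add: tdist_def)
  finally show ?thesis
    unfolding eq suminf_add[OF sm sm] .
qed

section \<open>Completeness of the path metric\<close>

lemma mcomplete_tdist: "Metric_space.mcomplete finite_ends tdist"
proof -
  interpret Metric_space finite_ends tdist by (rule Metric_space_tdist)
  show ?thesis unfolding mcomplete_def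
  proof (intro allI impI)
    fix s assume "MCauchy s"
    then have sc: "s n \<in> finite_ends" for n
      unfolding MCauchy_def by auto
    have cau: "\<exists>N. \<forall>m\<ge>N. \<forall>n\<ge>N. tdist (s m) (s n) < e" if "e > 0" for e
      using \<open>MCauchy s\<close> that unfolding MCauchy_def by metis
    have ev: "\<exists>N. \<forall>m\<ge>N. \<forall>n\<ge>N. agree k (s m) (s n)" if "k > 0" for k
    proof -
      obtain N where N: "\<And>m n. m \<ge> N \<Longrightarrow> n \<ge> N \<Longrightarrow> tdist (s m) (s n) < (1/2)^k"
        using cau[of "(1/2)^k"] by auto
      \<comment> \<open>The least period is at most \<open>k\<close>, so an unshared prefix of
        length \<open>k\<close> weighs at least \<open>(1/2)^k\<close>.\<close>
      have "agree k (s m) (s n)" if "m \<ge> N" "n \<ge> N" for m n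
      proof (rule ccontr)
        assume "\<not> ?thesis"
        then have "weight (s m) k \<le> gap (s m) (s n) k" by (simp add: gap_def)
        also have "\<dots> \<le> tdist (s m) (s n)" by (rule gap_le_tdist[OF sc sc])
        also have "\<dots> < (1/2)^k" by (rule N[OF that])
        also have "\<dots> \<le> weight (s m) k"
          using minper_le_length[OF \<open>k > 0\<close>] by (simp add: weight_def power_decreasing)
        finally show False by simp
      qed
      then show ?thesis by blast
    qed
    then obtain N where N: "\<And>k m n. k > 0 \<Longrightarrow> m \<ge> N k \<Longrightarrow> n \<ge> N k \<Longrightarrow> agree k (s m) (s n)"
      by metis
    \<comment> \<open>The first \<open>Suc i\<close> letters are constant from stage
      \<open>N (Suc i)\<close> on, so letter \<open>i\<close> of the limit is read there.\<close>
    define x where "x i = s (N (Suc i)) i" for i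
    have ag: "\<forall>\<^sub>F n in sequentially. agree k (s n) x" for k
    proof -
      have "\<forall>\<^sub>F n in sequentially. \<forall>i\<in>{..<k}. s n i = x i"
        using N[of "Suc _" _ "N (Suc _)"]
        by (intro eventually_ball_finite ballI)
          (auto simp: agree_def x_def eventually_sequentially intro!: exI[of _ "N (Suc _)"])
      then show ?thesis by (simp add: agree_def Ball_def)
    qed
    have weighteq: "weight y k = weight z k" if "agree j y z" "k \<le> j" for y z j k
      using minper_agree[OF agree_mono[OF that]] by (simp add: weight_def)
    obtain B where B: "\<And>m n. m \<ge> B \<Longrightarrow> n \<ge> B \<Longrightarrow> tdist (s m) (s n) < 1"
      using cau[of 1] by auto
    have weight_le: "weight (s m) k \<le> gap (s m) (s n) k + weight (s n) k" for m n k
      by (cases "agree k (s m) (s n)") (simp_all add: gap_def weighteq[of k "s m" "s n" k])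
    \<comment> \<open>Up to length \<open>K\<close>, \<open>x\<close> looks like a late
      \<open>s n\<close>, whose prefixes are shared with \<open>s B\<close> or counted in their
      distance. This bounds the sum independently of \<open>K\<close>.\<close>
    have part: "sum (weight x) {..<K} \<le> 1 + suminf (weight (s B))" for K
    proof -
      obtain n where n: "n \<ge> B" "agree K (s n) x"
        using eventually_conj[OF eventually_ge_at_top ag, of B K]
        by (metis (mono_tags, lifting) eventually_happens' sequentially_bot)
      have "sum (weight x) {..<K} = sum (weight (s n)) {..<K}"
        by (intro sum.cong refl) (metis weighteq n(2) less_imp_le lessThan_iff)
      also have "\<dots> \<le> (\<Sum>k<K. gap (s n) (s B) k + weight (s B) k)"
        by (intro sum_mono weight_le)
      also have "\<dots> \<le> tdist (s n) (s B) + suminf (weight (s B))"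
        unfolding sum.distrib tdist_def using sc summable_gap[OF sc sc]
        by (intro add_mono) (auto intro!: sum_le_suminf simp: finite_ends_def)
      finally show ?thesis using B[of n B] n(1) by simp
    qed
    have xc: "x \<in> finite_ends"
      unfolding finite_ends_def mem_Collect_eq
      by (rule bounded_imp_summable[OF weight_nonneg part[of "Suc _", unfolded lessThan_Suc_atMost]])
    have "\<exists>M. \<forall>m\<ge>M. tdist (s m) x < e" if e: "e > 0" for e
    proof -
      \<comment> \<open>Passing to the limit preserves only \<open>\<le>\<close>; taking
        \<open>e / 2\<close> keeps the final bound strict.\<close>
      obtain M where M: "\<And>m n. m \<ge> M \<Longrightarrow> n \<ge> M \<Longrightarrow> tdist (s m) (s n) < e / 2"
        using cau[OF half_gt_zero[OF e]] by blast
      have "tdist (s m) x \<le> e / 2" if "m \<ge> M" for m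
      proof -
        \<comment> \<open>Up to length \<open>K\<close>, a late \<open>s n\<close> can replace
          \<open>x\<close>, so each partial sum is bounded by a distance within the
          sequence.\<close>
        have "sum (gap (s m) x) {..<K} \<le> e / 2" for K
        proof -
          obtain n where n: "n \<ge> M" "agree K (s n) x"
            using eventually_conj[OF eventually_ge_at_top ag, of M K]
            by (metis (mono_tags, lifting) eventually_happens' sequentially_bot)
          have "gap (s n) x k = 0" if "k < K" for k
            using agree_mono[OF n(2), of k] that by (simp add: gap_def)
          then have "sum (gap (s m) x) {..<K} \<le> sum (gap (s m) (s n)) {..<K}"
            using gap_triangle[of "s m" x _ "s n"] by (intro sum_mono) (metis add.right_neutral lessThan_iff)
          also have "\<dots> \<le> tdist (s m) (s n)"
            unfolding tdist_def using sc summable_gap[OF sc sc] by (auto intro!: sum_le_suminf)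
          finally show ?thesis using M[OF \<open>m \<ge> M\<close> n(1)] by simp
        qed
        then show ?thesis
          using suminf_le_const[OF summable_gap[OF sc xc]] sc xc by (simp only: tdist_def simp_thms if_True)
      qed
      then show ?thesis using half_gt_zero[OF e] by (metis e field_sum_of_halves le_less_trans less_add_same_cancel1)
    qed
    then have "limitin mtopology s x sequentially"
      unfolding limit_metric_sequentially using xc sc by blast
    then show "\<exists>x. limitin mtopology s x sequentially" by blast
  qed
qed

section \<open>Periodic words are excluded, yet the space is nonempty\<close>

lemma periodic_not_finite_ends:
  assumes "p > 0" "\<And>i. x (i + p) = x i"
  shows "x \<notin> finite_ends"
proof
  assume "x \<in> finite_ends"
  then have "weight x \<longlonglongrightarrow> 0" by (simp add: finite_ends_def summable_LIMSEQ_zero)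
  \<comment> \<open>\<open>p\<close> is a period of every prefix, which keeps the weights away from
    0.\<close>
  moreover have "(1/2)^p \<le> weight x k" for k
    unfolding weight_def using minper_le[of p k x] assms
    by (intro power_decreasing) (auto simp: has_period_def)
  ultimately have "(1/2::real)^p \<le> 0"
    by (intro LIMSEQ_le_const) auto
  moreover have "(1/2::real)^p > 0" by simp
  ultimately show False by linarith
qed

text \<open>A period \<open>p < k\<close> would repeat the initial \<open>True\<close> at index
  \<open>p\<close>, so the weights decay geometrically.\<close>

lemma finite_ends_nonempty: "push True (\<lambda>_. False) \<in> finite_ends"
proof -
  let ?x = "push True (\<lambda>_. False)"
  have "k \<le> minper k ?x" for k
  proof (rule ccontr)
    assume *: "\<not> ?thesis"
    with has_period_minper[of k ?x] have "minper k ?x > 0" "?x (minper k ?x) = ?x 0"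
      unfolding has_period_def by (simp, metis add_0 not_le)
    then show False by (cases "minper k ?x") auto
  qed
  then have "\<forall>\<^sub>F k in sequentially. norm (weight ?x k) \<le> (1/2)^k"
    by (intro always_eventually) (simp add: weight_def power_decreasing)
  then show ?thesis
    unfolding finite_ends_def mem_Collect_eq
    by (rule summable_comparison_test_ev) (simp add: summable_geometric)
qed

section \<open>Transport to a carrier of reals and the two maps\<close>

lemma Metric_space_transport:
  assumes "Metric_space M d" "bij b"
  shows "Metric_space (b ` M) (\<lambda>r s. d (inv b r) (inv b s))"
proof -
  interpret Metric_space M d by fact
  have [simp]: "inv b (b x) = x" for x
    using assms(2) by (simp add: bij_is_inj)
  show ?thesis
    by unfold_locales (use bij_is_inj[OF assms(2)] in \<open>auto simp: commute triangle inj_eq\<close>)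
qed

lemma mcomplete_transport:
  assumes "Metric_space M d" "bij b" "Metric_space.mcomplete M d"
  shows "Metric_space.mcomplete (b ` M) (\<lambda>r s. d (inv b r) (inv b s))"
proof -
  interpret Metric_space M d by fact
  interpret B: Metric_space "b ` M" "\<lambda>r s. d (inv b r) (inv b s)"
    by (rule Metric_space_transport) fact+
  have [simp]: "inv b (b x) = x" for x
    using assms(2) by (simp add: bij_is_inj)
  have [simp]: "b (inv b x) = x" for x
    using assms(2) by (simp add: bij_is_surj surj_f_inv_f)
  show ?thesis unfolding B.mcomplete_def
  proof (intro allI impI)
    fix s assume s: "B.MCauchy s"
    then have "MCauchy (inv b \<circ> s)"
      unfolding MCauchy_def B.MCauchy_def by fastforce
    then obtain x where "limitin mtopology (inv b \<circ> s) x sequentially"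
      using assms(3) unfolding mcomplete_def by blast
    then have "limitin B.mtopology s (b x) sequentially"
      unfolding limit_metric_sequentially B.limit_metric_sequentially
      using s unfolding B.MCauchy_def comp_def by (simp add: image_subset_iff) blast
    then show "\<exists>x. limitin B.mtopology s x sequentially" ..
  qed
qed

lemma continuous_map_of_Lipschitz:
  assumes "Metric_space M d" "f \<in> M \<rightarrow> M"
    "\<And>x y. x \<in> M \<Longrightarrow> y \<in> M \<Longrightarrow> d (f x) (f y) \<le> C * d x y"
  shows "continuous_map (Metric_space.mtopology M d) (Metric_space.mtopology M d) f"
proof -
  interpret Metric_space M d by fact
  have "Lipschitz_continuous_map (metric (M,d)) (metric (M,d)) f"
    unfolding Lipschitz_continuous_map_def using assms(2,3) by auto
  from Lipschitz_continuous_imp_continuous_map[OF this] show ?thesis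
    by simp
qed

theorem mainTheorem1:
  "\<exists>(X :: real set) (\<rho> :: real \<Rightarrow> real \<Rightarrow> real) (S :: real \<Rightarrow> real) (T :: real \<Rightarrow> real).
     X \<noteq> {} \<and> Metric_space X \<rho> \<and> Metric_space.mcomplete X \<rho> \<and>
     S \<in> X \<rightarrow> X \<and> T \<in> X \<rightarrow> X \<and>
     continuous_map (Metric_space.mtopology X \<rho>) (Metric_space.mtopology X \<rho>) S \<and>
     continuous_map (Metric_space.mtopology X \<rho>) (Metric_space.mtopology X \<rho>) T \<and>
     (\<forall>x\<in>X. \<forall>y\<in>X. min (\<rho> (S x) (S y)) (\<rho> (T x) (T y)) \<le> 3 / 4 * \<rho> x y) \<and>
     (\<forall>R\<in>generated_semigroup {S, T}. \<not> (\<exists>x\<in>X. R x = x))"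
proof -
  \<comment> \<open>Words are indicator functions of sets of naturals, and those sets are relabelled
    by reals.\<close>
  obtain g :: "nat set \<Rightarrow> real" where g: "bij g"
    using nat_sets_eqpoll_reals unfolding eqpoll_def by blast
  define b where "b = g \<circ> (Collect :: (nat \<Rightarrow> bool) \<Rightarrow> nat set)"
  have "bij (Collect :: (nat \<Rightarrow> bool) \<Rightarrow> nat set)"
    by (rule o_bij[of "\<lambda>A x. x \<in> A"]) auto
  then have b: "bij b" unfolding b_def using g by (rule bij_comp)
  have [simp]: "inv b (b x) = x" for x
    using b by (simp add: bij_is_inj)
  define X where "X = b ` finite_ends"
  define \<rho> where "\<rho> = (\<lambda>r s. tdist (inv b r) (inv b s))"
  define P where "P c = b \<circ> push c \<circ> inv b" for c
  have invP: "inv b (P c r) = push c (inv b r)" for c r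
    by (simp add: P_def)
  have M: "Metric_space X \<rho>"
    unfolding X_def \<rho>_def by (rule Metric_space_transport[OF Metric_space_tdist b])
  then interpret Metric_space X \<rho> .
  have PX: "P c \<in> X \<rightarrow> X" for c
    by (auto simp: X_def P_def push_finite_ends)
  have sum: "\<rho> (P True r) (P True s) + \<rho> (P False r) (P False s) \<le> 3/2 * \<rho> r s"
    if "r \<in> X" "s \<in> X" for r s
    using that tdist_push_sum by (auto simp: X_def \<rho>_def P_def)
  \<comment> \<open>Dropping the other nonnegative summand leaves the Lipschitz constant 3/2, enough
    for continuity.\<close>
  have "\<rho> (P c r) (P c s) \<le> 3/2 * \<rho> r s" if "r \<in> X" "s \<in> X" for c r s
    using sum[OF that] nonneg[of "P True r" "P True s"] nonneg[of "P False r" "P False s"]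
    by (cases c; simp only:; linarith)
  then have cont: "continuous_map mtopology mtopology (P c)" for c
    by (intro continuous_map_of_Lipschitz[OF M PX])
  \<comment> \<open>In word coordinates a composition of \<open>n\<close> generators prepends
    \<open>n\<close> letters, so a fixed point would have period \<open>n\<close>.\<close>
  have shift: "\<exists>n>0. \<forall>r i. inv b (R r) (i + n) = inv b r i"
    if "R \<in> generated_semigroup {P True, P False}" for R
    using that
  proof induction
    case (generator R)
    then obtain c where "R = P c" by auto
    then show ?case by (intro exI[of _ 1]) (simp add: invP)
  next
    case (comp f g)
    then obtain m n where "m > 0" "\<And>r i. inv b (f r) (i + m) = inv b r i"
      and "\<And>r i. inv b (g r) (i + n) = inv b r i" by blast
    then show ?case
      by (intro exI[of _ "n + m"]) (simp add: add.assoc[symmetric])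
  qed
  have nofix: "R r \<noteq> r" if R: "R \<in> generated_semigroup {P True, P False}" and "r \<in> X" for R r
  proof
    assume "R r = r"
    with shift[OF R] obtain n where "n > 0" "\<And>i. inv b r (i + n) = inv b r i"
      by metis
    then have "inv b r \<notin> finite_ends" by (rule periodic_not_finite_ends)
    with \<open>r \<in> X\<close> show False by (auto simp: X_def)
  qed
  show ?thesis
  proof (rule exI[of _ X], rule exI[of _ \<rho>], rule exI[of _ "P True"],
      rule exI[of _ "P False"], intro conjI ballI)
    show "X \<noteq> {}" using finite_ends_nonempty by (auto simp: X_def)
    show "mcomplete"
      unfolding X_def \<rho>_def
      by (rule mcomplete_transport[OF Metric_space_tdist b mcomplete_tdist])
    show "min (\<rho> (P True r) (P True s)) (\<rho> (P False r) (P False s)) \<le> 3/4 * \<rho> r s"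
      if "r \<in> X" "s \<in> X" for r s
      \<comment> \<open>The smaller of two terms is at most half their sum.\<close>
      using sum[OF that] by linarith
  qed (use M PX cont nofix in auto)
qed

end
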